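(* Let $ABCD$ be a square. Let $H\in\overline{AD}$ and $G\in\overline{BC}$ be the points with $DH=\frac13 AD$ and $CG=\frac13 BC$, and let $E\in\overline{BC}$ be the point with $BE=\frac13 BC$. Suppose a fold of the square along a line (i.e. the reflection in that line) maps $B$ to a point $B'\in\overline{AD}$ and simultaneously maps $E$ to a point $E'\in\overline{HG}$. Then $B'$ divides the side $\overline{AD}$ in the ratio $\sqrt[3]{2}$, i.e. $\dfrac{DB'}{AB'}=\sqrt[3]{2}$.
   Context: The vertices $A,B,C,D$ of the square are listed in cyclic order. $\overline{XY}$ denotes the segment between $X$ and $Y$, and $XY$ its length. *)

theory Defs
  imports "HOL-Analysis.Analysis"
begin

text \<open>The vertices are in cyclic order; \<open>A \<noteq> B\<close> excludes the one-point configuration.\<close>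

definition is_square :: "real^2 \<Rightarrow> real^2 \<Rightarrow> real^2 \<Rightarrow> real^2 \<Rightarrow> bool" where
  "is_square A B C D \<longleftrightarrow>
     A \<noteq> B \<and>
     dist A B = dist B C \<and> dist B C = dist C D \<and> dist C D = dist D A \<and>
     orthogonal (D - A) (B - A) \<and> orthogonal (A - B) (C - B) \<and>
     orthogonal (B - C) (D - C) \<and> orthogonal (C - D) (A - D)"

definition is_line :: "(real^2) set \<Rightarrow> bool" where
  "is_line l \<longleftrightarrow> affine l \<and> aff_dim l = 1"

text \<open>For a line \<open>l\<close>, the closest point of \<open>l\<close> to \<open>P\<close> is the foot of the perpendicular
  from \<open>P\<close>, and it is the midpoint of \<open>P\<close> and its mirror image.\<close>

definition reflect :: "(real^2) set \<Rightarrow> real^2 \<Rightarrow> real^2" where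
  "reflect l P = 2 *\<^sub>R closest_point l P - P"

end

(* Put B at the origin and let u = C - B, v = A - B. Writing B' = A + t u and E' = G + w v,
   the displacements B' - B = t u + v and E' - E = u/3 + w v are both normal to the fold line,
   which gives t w = 1/3, and reflecting B E' onto B' E gives
   4/9 + w^2 = (t - 1/3)^2 + 1. Eliminating w yields
   (3 t + 1) (3 t^3 - 3 t^2 + 3 t - 1) = 0, and the second factor is 2 t^3 - (1 - t)^3. *)
theory Submission
  imports Defs
begin

text \<open>Otherwise \<open>u\<close>, \<open>v\<close>, \<open>x\<close> would be three nonzero
  pairwise orthogonal vectors, hence independent, in dimension 2.\<close>

lemma orthogonal_to_basis_plane:
  fixes u v x :: "real^2"
  assumes "u \<noteq> 0" "v \<noteq> 0" "u \<bullet> v = 0" "x \<bullet> u = 0" "x \<bullet> v = 0"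
  shows "x = 0"
proof (rule ccontr)
  assume "x \<noteq> 0"
  have "pairwise orthogonal {u, v, x}"
    using assms by (auto simp: pairwise_def orthogonal_def inner_commute)
  then have "independent {u, v, x}"
    using assms(1,2) \<open>x \<noteq> 0\<close> by (intro pairwise_orthogonal_independent) auto
  then have "card {u, v, x} \<le> 2"
    using independent_bound[of "{u, v, x}"] by simp
  moreover have "u \<noteq> v" "u \<noteq> x" "v \<noteq> x"
    using assms \<open>x \<noteq> 0\<close> by auto
  ultimately show False
    by simp
qed

lemma line_distinct_points:
  assumes "is_line l"
  obtains p q where "p \<in> l" "q \<in> l" "p \<noteq> q"
proof -
  have "aff_dim l = 1"
    using assms by (simp add: is_line_def)
  \<comment> \<open>Dimension 1 rules out the empty set (dimension -1) and single points (dimension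
    0).\<close>
  then have "l \<noteq> {}" "\<nexists>a. l = {a}"
    by (auto simp: aff_dim_empty)
  then show ?thesis
    using that by blast
qed

lemma line_closest_point_in:
  assumes "is_line l"
  shows "closest_point l P \<in> l"
  using assms line_distinct_points[OF assms]
  by (metis affine_closed closest_point_in_set empty_iff is_line_def)

text \<open>The foot of the perpendicular satisfies the obtuse-angle inequality of a closed convex
  set. On a line it can be applied in both directions, so it becomes an equality. The difference
  \<open>x - y\<close> stands for the direction of the line.\<close>

lemma line_closest_point_orthogonal:
  assumes "is_line l" "x \<in> l" "y \<in> l"
  shows "(P - closest_point l P) \<bullet> (x - y) = 0"
proof -
  let ?c = "closest_point l P"
  have aff: "affine l"
    using assms(1) by (simp add: is_line_def)
  have le: "(P - ?c) \<bullet> (z - ?c) \<le> 0" if "z \<in> l" for z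
    using closest_point_dot[OF affine_imp_convex[OF aff] affine_closed[OF aff] that] .
  have eq: "(P - ?c) \<bullet> (z - ?c) = 0" if "z \<in> l" for z
  proof -
    \<comment> \<open>The point of the line opposite to \<open>z\<close> with respect to
      \<open>?c\<close>; it supplies the reverse inequality.\<close>
    have "2 *\<^sub>R ?c + (-1) *\<^sub>R z \<in> l"
      using aff that line_closest_point_in[OF assms(1)] by (intro mem_affine) auto
    from le[OF this] le[OF that] show ?thesis
      by (simp add: inner_diff_right inner_add_right)
  qed
  from eq[OF assms(2)] eq[OF assms(3)] show ?thesis
    by (simp add: inner_diff_right)
qed

lemma reflect_displacement_orthogonal:
  assumes "is_line l" "x \<in> l" "y \<in> l"
  shows "(reflect l P - P) \<bullet> (x - y) = 0"
proof -
  have "reflect l P - P = (-2) *\<^sub>R (P - closest_point l P)"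
    by (simp add: reflect_def algebra_simps scaleR_2)
  then show ?thesis
    using line_closest_point_orthogonal[OF assms] by simp
qed

text \<open>With \<open>?c - ?d\<close> along the line and \<open>?n\<close> normal to it, the two
  difference vectors are \<open>(?c - ?d) - ?n\<close> and \<open>(?c - ?d) + ?n\<close>, which have
  equal length by Pythagoras.\<close>

lemma dist_reflect_swap:
  assumes "is_line l"
  shows "dist (reflect l P) Q = dist P (reflect l Q)"
proof -
  let ?c = "closest_point l P" and ?d = "closest_point l Q"
  let ?n = "(P - ?c) + (Q - ?d)"
  have "orthogonal (?c - ?d) ?n"
    using line_closest_point_orthogonal[OF assms line_closest_point_in line_closest_point_in] assms
    by (simp add: orthogonal_def inner_add_right inner_commute[of "?c - ?d"])
  moreover have "norm (a - n) = norm (a + n)" if "orthogonal a n" for a n :: "real^2"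
    using that by (simp add: norm_eq orthogonal_def algebra_simps inner_commute)
  ultimately have "norm ((?c - ?d) - ?n) = norm ((?c - ?d) + ?n)"
    by blast
  moreover have "reflect l P - Q = (?c - ?d) - ?n" "P - reflect l Q = (?c - ?d) + ?n"
    by (simp_all add: reflect_def algebra_simps scaleR_2)
  ultimately show ?thesis
    by (simp only: dist_norm)
qed

text \<open>The right angles at \<open>A\<close>, \<open>B\<close> and \<open>C\<close> make
  \<open>D - A - (C - B)\<close> orthogonal to both sides that meet at \<open>B\<close>, which
  forces it to vanish in the plane.\<close>

lemma square_fourth_vertex:
  assumes "is_square A B C D"
  shows "D = A + (C - B)"
proof -
  note sq = assms[unfolded is_square_def orthogonal_def]
  have "A - B \<noteq> 0" "C - B \<noteq> 0"
    using sq by auto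
  moreover have "(C - B) \<bullet> (A - B) = 0"
    using sq by (simp add: inner_commute)
  moreover have "(D - A - (C - B)) \<bullet> (C - B) = 0" "(D - A - (C - B)) \<bullet> (A - B) = 0"
    using sq by (auto simp: algebra_simps inner_commute)
  ultimately have "D - A - (C - B) = 0"
    by (metis orthogonal_to_basis_plane)
  then show ?thesis
    by (simp add: algebra_simps)
qed

lemma closed_segment_dist_fraction:
  fixes P Q X :: "'a::euclidean_space"
  assumes "X \<in> closed_segment P Q" "dist P X = r * dist P Q"
  shows "X = P + r *\<^sub>R (Q - P)"
proof -
  obtain t where t: "0 \<le> t" "X = P + t *\<^sub>R (Q - P)"
    using assms(1) by (auto simp: in_segment algebra_simps)
  then have "t * dist P Q = r * dist P Q"
    using assms(2) by (simp add: dist_norm norm_minus_commute)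
  \<comment> \<open>Either \<open>P = Q\<close>, and then both expressions equal \<open>P\<close>,
    or the distance cancels and \<open>t = r\<close>.\<close>
  then show ?thesis
    using t by auto
qed

lemma fold_quartic_factor:
  fixes t w :: real
  assumes "0 \<le> t" "t * w = 1/3" "4/9 + w\<^sup>2 = (t - 1/3)\<^sup>2 + 1"
  shows "(1 - t)^3 = 2 * t^3"
proof -
  \<comment> \<open>The factor \<open>t\<^sup>2\<close> lets \<open>w\<close> enter only through
    \<open>t * w\<close>, whose value is known.\<close>
  have "t\<^sup>2 * (4/9) + (t * w)\<^sup>2 = t\<^sup>2 * ((t - 1/3)\<^sup>2 + 1)"
    unfolding assms(3)[symmetric] by (simp add: power_mult_distrib distrib_left)
  then have "(3 * t + 1) * (2 * t^3 - (1 - t)^3) = 0"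
    unfolding assms(2) by (simp add: algebra_simps power2_eq_square power3_eq_cube)
  \<comment> \<open>Since \<open>t\<close> is non-negative, \<open>3 * t + 1\<close> is positive and
    can be cancelled.\<close>
  then show ?thesis
    using assms(1) by auto
qed

theorem mainTheorem4:
  fixes A B C D E G H B' E' :: "real^2" and l :: "(real^2) set"
  assumes "is_square A B C D"
    and "H \<in> closed_segment A D" and "dist D H = 1/3 * dist A D"
    and "G \<in> closed_segment B C" and "dist C G = 1/3 * dist B C"
    and "E \<in> closed_segment B C" and "dist B E = 1/3 * dist B C"
    and "is_line l"
    and "B' = reflect l B" and "B' \<in> closed_segment A D"
    and "E' = reflect l E" and "E' \<in> closed_segment H G"
  shows "dist D B' / dist A B' = root 3 2"
proof -
  define u v where "u = C - B" and "v = A - B"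
  have "norm v = norm u"
    using assms(1) by (simp add: is_square_def u_def v_def dist_norm norm_minus_commute)
  then have uv: "u \<bullet> v = 0" "u \<noteq> 0" "v \<noteq> 0" "v \<bullet> v = u \<bullet> u"
    using assms(1) unfolding is_square_def orthogonal_def norm_eq
    by (auto simp: u_def v_def inner_commute)
  have A: "A = B + v" and C: "C = B + u" and D: "D = B + v + u"
    using square_fourth_vertex[OF assms(1)] by (simp_all add: u_def v_def)
  have E: "E = B + (1/3) *\<^sub>R u"
    using closed_segment_dist_fraction[OF assms(6,7)] by (simp add: C)
  \<comment> \<open>The given thirds for \<open>G\<close> and \<open>H\<close> are measured from
    \<open>C\<close> and \<open>D\<close>, so they become two thirds from \<open>B\<close> and
    \<open>A\<close>.\<close>
  have "G = C + (1/3) *\<^sub>R (B - C)"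
    using assms(4,5) by (intro closed_segment_dist_fraction)
      (simp_all add: closed_segment_commute dist_commute)
  then have G: "G = B + (2/3) *\<^sub>R u"
    by (simp add: C vec_eq_iff)
  have "H = D + (1/3) *\<^sub>R (A - D)"
    using assms(2,3) by (intro closed_segment_dist_fraction)
      (simp_all add: closed_segment_commute dist_commute)
  then have H: "H = B + v + (2/3) *\<^sub>R u"
    by (simp add: A D vec_eq_iff)
  obtain t where t: "0 \<le> t" "t \<le> 1" and B': "B' = B + v + t *\<^sub>R u"
    using assms(10) by (auto simp: in_segment A D algebra_simps)
  obtain r where E'_r: "E' = (1 - r) *\<^sub>R H + r *\<^sub>R G"
    using assms(12) by (auto simp: in_segment)
  \<comment> \<open>Since \<open>H = G + v\<close>, the weight of \<open>H\<close> in
    \<open>E'\<close> is its coordinate along \<open>v\<close>.\<close>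
  define w where "w = 1 - r"
  have E': "E' = B + (2/3) *\<^sub>R u + w *\<^sub>R v"
    unfolding E'_r G H w_def by (simp add: vec_eq_iff field_simps)
  obtain p q where pq: "p \<in> l" "q \<in> l" "p \<noteq> q"
    using line_distinct_points[OF assms(8)] .
  have "(B' - B) \<bullet> (p - q) = 0" "(E' - E) \<bullet> (p - q) = 0"
    unfolding assms(9,11) using reflect_displacement_orthogonal[OF assms(8) pq(1,2)] by blast+
  moreover have "B' - B = t *\<^sub>R u + v" "E' - E = (1/3) *\<^sub>R u + w *\<^sub>R v"
    unfolding B' E' E by (simp_all add: algebra_simps flip: scaleR_left_distrib)
  ultimately have n: "t * (u \<bullet> (p - q)) + v \<bullet> (p - q) = 0"
      "1/3 * (u \<bullet> (p - q)) + w * (v \<bullet> (p - q)) = 0"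
    by (simp_all add: inner_add_left)
  \<comment> \<open>If the fold line were orthogonal to \<open>u\<close>, the first equation would
    make its direction orthogonal to \<open>v\<close> as well, hence zero.\<close>
  have "u \<bullet> (p - q) \<noteq> 0"
  proof
    assume "u \<bullet> (p - q) = 0"
    moreover from this have "v \<bullet> (p - q) = 0"
      using n(1) by simp
    ultimately have "p - q = 0"
      using orthogonal_to_basis_plane[OF uv(2,3,1)] by (metis inner_commute)
    then show False
      using pq(3) by simp
  qed
  \<comment> \<open>The second equation minus \<open>w\<close> times the first.\<close>
  moreover have "(1/3 - t * w) * (u \<bullet> (p - q)) = 0"
    using n by algebra
  ultimately have tw: "t * w = 1/3"
    by simp
  have "dist B' E = dist B E'"
    unfolding assms(9,11) by (rule dist_reflect_swap[OF assms(8)])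
  moreover have "B' - E = (t - 1/3) *\<^sub>R u + v" "B - E' = - ((2/3) *\<^sub>R u + w *\<^sub>R v)"
    unfolding B' E' E by (simp_all add: algebra_simps)
  ultimately have "norm ((t - 1/3) *\<^sub>R u + v) = norm ((2/3) *\<^sub>R u + w *\<^sub>R v)"
    by (simp only: dist_norm norm_minus_cancel)
  then have "((t - 1/3)\<^sup>2 + 1) * (u \<bullet> u) = (4/9 + w\<^sup>2) * (u \<bullet> u)"
    unfolding norm_eq using uv(1,4)
    by (simp add: inner_add_left inner_add_right inner_commute[of v u] power2_eq_square
        distrib_right)
  then have "4/9 + w\<^sup>2 = (t - 1/3)\<^sup>2 + 1"
    using uv(2) by simp
  from fold_quartic_factor[OF t(1) tw this] have cubic: "(1 - t)^3 = 2 * t^3" .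
  have "t \<noteq> 0"
    using tw by auto
  then have "((1 - t) / t)^3 = 2"
    using cubic by (simp add: power_divide)
  \<comment> \<open>As \<open>B'\<close> lies on the side, \<open>t\<close> is between 0 and 1; the
    quotient is thus non-negative, as \<open>real_root_pos2\<close> requires.\<close>
  then have "(1 - t) / t = root 3 2"
    using t by (metis divide_nonneg_nonneg diff_ge_0_iff_ge real_root_pos2 zero_less_numeral)
  moreover have "D - B' = (1 - t) *\<^sub>R u" "A - B' = - (t *\<^sub>R u)"
    unfolding A D B' by (simp_all add: algebra_simps)
  then have "dist D B' = (1 - t) * norm u" "dist A B' = t * norm u"
    using t by (simp_all add: dist_norm)
  ultimately show ?thesis
    using uv(2) by simp
qed

end
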